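(* Let $k\ge2$ and let $G$ be a $k$-graph with $n$ vertices in which every vertex lies in at least one edge, with minimum degree $\delta$, average degree $\bar d$, edge connectivity $e(G)$ and maximum cut $c(G)$. Then: (a) $e(G)\le\delta$. (b) $c(G)\le\frac nk(2\bar d-\delta)$. (c) If $n\le 2k-1$, then $e(G)=\delta$.
   Context: A $k$-graph $G=(V,E)$ consists of a vertex set $V=\{1,\dots,n\}$ and a set $E$ of distinct $k$-element subsets of $V$ (edges). Standing assumption: every vertex lies in at least one edge. The degree $d_i$ of vertex $i$ is the number of edges containing $i$; $\delta=\min_i d_i$ and $\bar d=\frac1n\sum_{i=1}^n d_i$. For a proper nonempty subset $S$ of $V$ with complement $\bar S=V\setminus S$, the edge cut $E(S,\bar S)$ is the set of edges that contain at least one vertex of $S$ and at least one vertex of $\bar S$. The edge connectivity $e(G)$ is the minimum, and the maximum cut $c(G)$ is the maximum, of the cardinality $|E(S,\bar S)|$ over all proper nonempty subsets $S$ of $V$. *)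

theory Defs
  imports Complex_Main
begin

definition kgraph :: "nat \<Rightarrow> nat \<Rightarrow> nat set set \<Rightarrow> bool" where
  "kgraph k n E \<longleftrightarrow> (\<forall>e\<in>E. e \<subseteq> {1..n} \<and> card e = k)"

definition degree :: "nat set set \<Rightarrow> nat \<Rightarrow> nat" where
  "degree E i = card {e \<in> E. i \<in> e}"

text \<open>The extrema below are meaningful only when their index sets are nonempty: \<open>n \<ge> 1\<close> for the
  degrees and \<open>n \<ge> 2\<close> for the cuts.\<close>

definition min_degree :: "nat \<Rightarrow> nat set set \<Rightarrow> nat" where
  "min_degree n E = Min (degree E ` {1..n})"

definition avg_degree :: "nat \<Rightarrow> nat set set \<Rightarrow> real" where
  "avg_degree n E = (1 / real n) * (\<Sum>i=1..n. real (degree E i))"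

definition edge_cut :: "nat \<Rightarrow> nat set set \<Rightarrow> nat set \<Rightarrow> nat set set" where
  "edge_cut n E S = {e \<in> E. e \<inter> S \<noteq> {} \<and> e \<inter> ({1..n} - S) \<noteq> {}}"

definition edge_connectivity :: "nat \<Rightarrow> nat set set \<Rightarrow> nat" where
  "edge_connectivity n E = Min ((\<lambda>S. card (edge_cut n E S)) ` {S. S \<noteq> {} \<and> S \<subset> {1..n}})"

definition max_cut :: "nat \<Rightarrow> nat set set \<Rightarrow> nat" where
  "max_cut n E = Max ((\<lambda>S. card (edge_cut n E S)) ` {S. S \<noteq> {} \<and> S \<subset> {1..n}})"

end

theory Submission
  imports Defs
begin

text \<open>A singleton \<open>{i}\<close> cuts exactly the edges at \<open>i\<close>. The bound on the maximum cut follows already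
  from the trivial estimate \<open>c(G) \<le> |E|\<close>, because \<open>k |E|\<close> is the degree sum and hence at
  least \<open>n \<delta>\<close>. If \<open>n < 2 k\<close>, one side of every cut has fewer than \<open>k\<close> vertices, so it
  contains no edge and all edges at any of its vertices are cut.\<close>

lemma kgraph_finite: "kgraph k n E \<Longrightarrow> finite E"
  unfolding kgraph_def by (rule finite_subset[of _ "Pow {1..n}"]) auto

text \<open>Double counting of the incidences between vertices and edges: each edge is met by
  exactly \<open>k\<close> of the vertices.\<close>

lemma degree_sum:
  assumes "kgraph k n E"
  shows "(\<Sum>i=1..n. degree E i) = k * card E"
proof -
  have E: "card {i \<in> {1..n}. i \<in> e} = k" if "e \<in> E" for e
  proof -
    have "{i \<in> {1..n}. i \<in> e} = e" using assms that unfolding kgraph_def by blast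
    then show ?thesis using assms that unfolding kgraph_def by simp
  qed
  have "(\<Sum>i=1..n. card {e \<in> E. i \<in> e}) = k * card E"
    by (rule sum_multicount) (use E kgraph_finite[OF assms] in auto)
  then show ?thesis by (simp add: degree_def)
qed

lemma min_degree_le: "i \<in> {1..n} \<Longrightarrow> min_degree n E \<le> degree E i"
  unfolding min_degree_def by simp

lemma edge_cut_complement:
  assumes "S \<subseteq> {1..n}"
  shows "edge_cut n E ({1..n} - S) = edge_cut n E S"
  using assms unfolding edge_cut_def by (auto simp: double_diff)

text \<open>Since \<open>k \<ge> 2\<close>, no edge fits inside \<open>{i}\<close>, so each edge at
  \<open>i\<close> also has a vertex on the other side.\<close>

lemma edge_cut_singleton:
  assumes "kgraph k n E" "k \<ge> 2"
  shows "edge_cut n E {i} = {e \<in> E. i \<in> e}"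
proof -
  have "e \<inter> ({1..n} - {i}) \<noteq> {}" if "e \<in> E" for e
  proof
    assume "e \<inter> ({1..n} - {i}) = {}"
    then have "e \<subseteq> {i}" using assms that unfolding kgraph_def by blast
    then have "card e \<le> 1" using card_mono[of "{i}" e] by simp
    then show False using assms that unfolding kgraph_def by auto
  qed
  then show ?thesis unfolding edge_cut_def by blast
qed

text \<open>A set with fewer than \<open>k\<close> vertices is too small to contain an edge, so
  every edge through \<open>i\<close> leaves \<open>S\<close>.\<close>

lemma degree_le_card_edge_cut:
  assumes G: "kgraph k n E" and S: "S \<subseteq> {1..n}" "card S < k" and i: "i \<in> S"
  shows "degree E i \<le> card (edge_cut n E S)"
  unfolding degree_def
proof (rule card_mono)
  show "finite (edge_cut n E S)"
    using kgraph_finite[OF G] unfolding edge_cut_def by simp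
  have "e \<inter> ({1..n} - S) \<noteq> {}" if "e \<in> E" for e
  proof
    assume "e \<inter> ({1..n} - S) = {}"
    then have "e \<subseteq> S" using G that unfolding kgraph_def by blast
    then have "card e \<le> card S" using S(1) by (meson card_mono finite_atLeastAtMost finite_subset)
    then show False using G S(2) that unfolding kgraph_def by auto
  qed
  then show "{e \<in> E. i \<in> e} \<subseteq> edge_cut n E S"
    using i unfolding edge_cut_def by blast
qed

text \<open>Two sides with at least \<open>k\<close> vertices each would need \<open>2 * k\<close>
  vertices. As a cut is symmetric in its sides, the preceding bound can be applied to the smaller
  one.\<close>

lemma min_degree_le_card_edge_cut:
  assumes G: "kgraph k n E" and n: "n \<le> 2 * k - 1" and S: "S \<noteq> {}" "S \<subset> {1..n}"
  shows "min_degree n E \<le> card (edge_cut n E S)"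
proof -
  have small: "min_degree n E \<le> card (edge_cut n E T)"
    if "T \<subseteq> {1..n}" "T \<noteq> {}" "card T < k" for T
  proof -
    obtain i where i: "i \<in> T" using \<open>T \<noteq> {}\<close> by blast
    then have "min_degree n E \<le> degree E i" using that(1) by (intro min_degree_le) blast
    also have "\<dots> \<le> card (edge_cut n E T)"
      using degree_le_card_edge_cut[OF G that(1,3) i] .
    finally show ?thesis .
  qed
  show ?thesis
  proof (cases "card S < k")
    case True
    then show ?thesis using small S by blast
  next
    case False
    have "card ({1..n} - S) = n - card S"
      using S(2) by (subst card_Diff_subset) (auto intro: finite_subset)
    moreover have "0 < card S" using S finite_subset[of S "{1..n}"] by (auto simp: card_gt_0_iff)
    \<comment> \<open>Here \<open>card S \<ge> k\<close> leaves at most \<open>k - 1\<close>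
      vertices. The strict inclusion gives \<open>card S < n\<close>, which excludes
      \<open>k = 0\<close>, where the subtraction in \<open>2 * k - 1\<close> would
      truncate.\<close>
    ultimately have "card ({1..n} - S) < k"
      using False n S(2) psubset_card_mono[of "{1..n}" S] by simp
    then show ?thesis
      using small[of "{1..n} - S"] S edge_cut_complement[of S n E] by auto
  qed
qed

theorem proposition16:
  fixes k n :: nat and E :: "nat set set"
  assumes "k \<ge> 2"
    and "n \<ge> 1"
    and "kgraph k n E"
    and "\<forall>i\<in>{1..n}. \<exists>e\<in>E. i \<in> e"
  shows "edge_connectivity n E \<le> min_degree n E
    \<and> real (max_cut n E) \<le> real n / real k * (2 * avg_degree n E - real (min_degree n E))
    \<and> (n \<le> 2 * k - 1 \<longrightarrow> edge_connectivity n E = min_degree n E)"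
proof -
  note G = assms(3)
  define C where "C = {S. S \<noteq> {} \<and> S \<subset> {1..n}}"
  have "finite C" unfolding C_def by (rule finite_subset[of _ "Pow {1..n}"]) auto
  \<comment> \<open>An edge at vertex 1 forces \<open>n \<ge> k \<ge> 2\<close>. Hence proper
    nonempty vertex sets exist, and \<open>Min\<close> and \<open>Max\<close> over the cuts are
    genuine extrema.\<close>
  obtain e where e: "e \<in> E" using assms(2,4) by force
  have "k \<le> n"
    using e G card_mono[of "{1..n}" e] unfolding kgraph_def by auto
  then have "n \<ge> 2" using assms(1) by simp
  have singleton: "{i} \<in> C" if "i \<in> {1..n}" for i
  proof -
    have "{i} \<noteq> {1..n}"
    proof
      assume "{i} = {1..n}"
      then have "card {i} = card {1..n}" by (rule arg_cong)
      then show False using \<open>n \<ge> 2\<close> by simp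
    qed
    then show ?thesis using that unfolding C_def by auto
  qed
  then have "C \<noteq> {}" using assms(2) by force
  \<comment> \<open>A vertex \<open>i\<close> attaining the minimum degree supplies the cut
    \<open>{i}\<close> that witnesses (a).\<close>
  have "min_degree n E \<in> degree E ` {1..n}"
    unfolding min_degree_def using assms(2) by (intro Min_in) auto
  then obtain i where i: "i \<in> {1..n}" "min_degree n E = degree E i" by blast
  have a: "edge_connectivity n E \<le> min_degree n E"
  proof -
    have "edge_connectivity n E \<le> card (edge_cut n E {i})"
      unfolding edge_connectivity_def C_def[symmetric]
      using \<open>finite C\<close> singleton[OF i(1)] by (intro Min_le) auto
    then show ?thesis using edge_cut_singleton[OF G assms(1)] i(2) by (simp add: degree_def)
  qed
  have b: "real (max_cut n E) \<le> real n / real k * (2 * avg_degree n E - real (min_degree n E))"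
  proof -
    have "max_cut n E \<le> card E"
      unfolding max_cut_def C_def[symmetric]
      using \<open>finite C\<close> \<open>C \<noteq> {}\<close> kgraph_finite[OF G]
      by (auto simp: edge_cut_def intro!: card_mono)
    then have cut: "real (max_cut n E) \<le> real (card E)" by simp
    have "n * min_degree n E \<le> (\<Sum>i=1..n. degree E i)"
      using sum_bounded_below[of "{1..n}" "min_degree n E" "degree E"] min_degree_le by simp
    then have "n * min_degree n E \<le> k * card E" by (simp only: degree_sum[OF G])
    then have deg: "real n * real (min_degree n E) \<le> real k * real (card E)"
      by (simp only: of_nat_mult[symmetric] of_nat_le_iff)
    have "(\<Sum>i=1..n. real (degree E i)) = real k * real (card E)"
      by (simp only: degree_sum[OF G] of_nat_sum[symmetric] of_nat_mult)
    then have avg: "real n * avg_degree n E = real k * real (card E)"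
      using assms(2) by (simp add: avg_degree_def)
    have "real k * real (max_cut n E) \<le> real k * real (card E)"
      using cut by (rule mult_left_mono) simp
    \<comment> \<open>By \<open>avg\<close> the term with the average equals
      \<open>2 * k * card E\<close>, and by \<open>deg\<close> the subtracted term is at most
      \<open>k * card E\<close>.\<close>
    also have "\<dots> \<le> real n * (2 * avg_degree n E - real (min_degree n E))"
      using avg deg by (simp add: right_diff_distrib)
    finally show ?thesis using assms(1) by (simp add: field_simps)
  qed
  \<comment> \<open>Every cut is bounded below, hence so is the minimum; the equality in (c) then
    follows with \<open>a\<close> by antisymmetry.\<close>
  have c: "min_degree n E \<le> edge_connectivity n E" if "n \<le> 2 * k - 1"
    unfolding edge_connectivity_def C_def[symmetric]
    using \<open>finite C\<close> \<open>C \<noteq> {}\<close> min_degree_le_card_edge_cut[OF G that]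
    by (auto simp: C_def)
  show ?thesis using a b c by (auto intro: antisym)
qed

end
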